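(* Let $n\ge2$ and $m,l\ge2$ be integers, and let $(\bar\Lambda,\bar\Theta,\bar K)\in\mathcal F_{m,n}\times\mathcal F_{l,n}\times\mathscr C(\mathbb R^n)$. If the leading tensor pair $(\bar{\mathcal A}^{(1)},\bar{\mathcal B}^{(1)})$ in $(\bar\Lambda,\bar\Theta)$ is an $\mathbf R_0^{\bar K}$-tensor pair, then the set $$\mathrm D_{\mathrm{SOL}}:=\{(\boldsymbol a,\boldsymbol b)\in\mathbb R^n\times\mathbb R^n\mid\mathrm{SOL}(\bar\Lambda,\boldsymbol a,\bar\Theta,\boldsymbol b,\bar K)\neq\emptyset\}$$ is closed.
   Context: $\mathbb T_{m,n}$ is the space of real $m$-th order $n$-dimensional square tensors $\mathcal A=(a_{j_1\ldots j_m})$, $1\le j_1,\ldots,j_m\le n$. $\mathcal F_{m,n}:=\mathbb T_{m,n}\times\mathbb T_{m-1,n}\times\cdots\times\mathbb T_{2,n}$, with elements written $\Lambda=(\mathcal A^{(1)},\ldots,\mathcal A^{(m-1)})$, $\mathcal A^{(k)}\in\mathbb T_{m-k+1,n}$; elements of $\mathcal F_{l,n}$ are written $\Theta=(\mathcal B^{(1)},\ldots,\mathcal B^{(l-1)})$. The leading tensor pair of $(\Lambda,\Theta)$ is $(\mathcal A^{(1)},\mathcal B^{(1)})$. For $\mathcal A\in\mathbb T_{m,n}$ and $\boldsymbol x\in\mathbb R^n$, $\mathcal A\boldsymbol x^{m-1}\in\mathbb R^n$ has $j$-th component $\sum_{j_2,\ldots,j_m=1}^n a_{jj_2\ldots j_m}x_{j_2}\cdots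 x_{j_m}$. $\mathscr C(\mathbb R^n)$ is the set of nonzero closed convex cones in $\mathbb R^n$. The dual cone of $K$ is $K^*:=\{\boldsymbol y\in\mathbb R^n\mid\langle\boldsymbol y,\boldsymbol x\rangle\ge0\ \forall\boldsymbol x\in K\}$. $\mathrm{SOL}(\Lambda,\boldsymbol a,\Theta,\boldsymbol b,K)$ is the set of all $\boldsymbol x\in\mathbb R^n$ with $F(\boldsymbol x)\in K$, $G(\boldsymbol x)\in K^*$, $\langle F(\boldsymbol x),G(\boldsymbol x)\rangle=0$, where $F(\boldsymbol x):=\sum_{k=1}^{m-1}\mathcal A^{(k)}\boldsymbol x^{m-k}+\boldsymbol a$ and $G(\boldsymbol x):=\sum_{p=1}^{l-1}\mathcal B^{(p)}\boldsymbol x^{l-p}+\boldsymbol b$. A pair $(\mathcal A,\mathcal B)\in\mathbb T_{m,n}\times\mathbb T_{l,n}$ is an $\mathbf R_0^K$-tensor pair if there exists no $\boldsymbol x\in\mathbb R^n\setminus\{\boldsymbol 0\}$ such that $\mathcal A\boldsymbol x^{m-1}\in K$, $\mathcal B\boldsymbol x^{l-1}\in K^*$ and $\langle\mathcal A\boldsymbol x^{m-1},\mathcal B\boldsymbol x^{l-1}\rangle=0$. *)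

theory Defs
  imports "HOL-Analysis.Analysis"
begin

text \<open>
  A real tensor of order \<open>m\<close> and dimension \<open>CARD('n)\<close> is a function on index lists of
  length \<open>m\<close>; elements of the spaces below are \<open>undefined\<close> outside their index sets, so that
  distinct functions in a space are distinct tensors (respectively tuples of tensors).
\<close>

type_synonym 'n tensor = "'n list \<Rightarrow> real"

definition tensors :: "nat \<Rightarrow> ('n::finite) tensor set" where
  "tensors m = ({js. length js = m} \<rightarrow>\<^sub>E UNIV)"

definition tensor_tuples :: "nat \<Rightarrow> (nat \<Rightarrow> ('n::finite) tensor) set" where
  "tensor_tuples m = (\<Pi>\<^sub>E k\<in>{1..m - 1}. tensors (m - k + 1))"

text \<open>
  \<open>tensor_pow A x r\<close> is the vector \<open>A x\<^sup>r\<close>, for a tensor \<open>A\<close> of order \<open>r + 1\<close>;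
  the list \<open>js\<close> stands for the indices in positions \<open>2, \<dots>, r + 1\<close>.
\<close>

definition tensor_pow :: "('n::finite) tensor \<Rightarrow> real ^ 'n \<Rightarrow> nat \<Rightarrow> real ^ 'n" where
  "tensor_pow A x r =
     (\<chi> j. \<Sum>js | length js = r. A (j # js) * (\<Prod>i\<leftarrow>js. x $ i))"

definition poly_map ::
  "nat \<Rightarrow> (nat \<Rightarrow> ('n::finite) tensor) \<Rightarrow> real ^ 'n \<Rightarrow> real ^ 'n \<Rightarrow> real ^ 'n" where
  "poly_map m \<Lambda> a x = (\<Sum>k = 1..m - 1. tensor_pow (\<Lambda> k) x (m - k)) + a"

text \<open>
  \<^const>\<open>convex_cone\<close> requires closure under multiplication by all \<open>c \<ge> 0\<close> and nonemptiness;
  nonzero means different from \<open>{0}\<close>.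
\<close>

definition nonzero_closed_convex_cones :: "(real ^ 'n::finite) set set" where
  "nonzero_closed_convex_cones = {K. convex_cone K \<and> closed K \<and> K \<noteq> {0}}"

definition dual_cone :: "(real ^ 'n::finite) set \<Rightarrow> (real ^ 'n) set" where
  "dual_cone K = {y. \<forall>x\<in>K. y \<bullet> x \<ge> 0}"

definition SOL ::
  "nat \<Rightarrow> nat \<Rightarrow> (nat \<Rightarrow> ('n::finite) tensor) \<Rightarrow> real ^ 'n \<Rightarrow>
   (nat \<Rightarrow> 'n tensor) \<Rightarrow> real ^ 'n \<Rightarrow> (real ^ 'n) set \<Rightarrow> (real ^ 'n) set" where
  "SOL m l \<Lambda> a \<Theta> b K =
     {x. poly_map m \<Lambda> a x \<in> K \<and> poly_map l \<Theta> b x \<in> dual_cone K \<and>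
         poly_map m \<Lambda> a x \<bullet> poly_map l \<Theta> b x = 0}"

definition R0_tensor_pair ::
  "nat \<Rightarrow> nat \<Rightarrow> (real ^ 'n) set \<Rightarrow> ('n::finite) tensor \<Rightarrow> 'n tensor \<Rightarrow> bool" where
  "R0_tensor_pair m l K A B \<longleftrightarrow>
     \<not> (\<exists>x. x \<noteq> 0 \<and> tensor_pow A x (m - 1) \<in> K \<and> tensor_pow B x (l - 1) \<in> dual_cone K \<and>
            tensor_pow A x (m - 1) \<bullet> tensor_pow B x (l - 1) = 0)"

end

theory Submission
  imports Defs
begin

text \<open>
  Homogenise: for \<open>s > 0\<close>, a point \<open>x\<close> is a solution iff \<open>(s, u) = (s, s x)\<close> satisfies the
  homogenised conditions, and \<open>s\<close> may be scaled so that \<open>(s, u)\<close> is a unit vector. The points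
  at infinity (\<open>s = 0\<close>) see only the leading tensors and are excluded by the
  \<open>R\<^sub>0\<close> property. Hence the set in question is the projection of a closed
  set along the compact half sphere \<open>{(s, u). s \<ge> 0 \<and> norm (s, u) = 1}\<close>.
\<close>

text \<open>The homogenisation of \<open>poly_map\<close> of degree \<open>m - 1\<close> in
  \<open>(s, u)\<close>. It is written as a polynomial rather than as a rescaled
  \<open>poly_map\<close> at \<open>u / s\<close>, so it stays meaningful and continuous at
  \<open>s = 0\<close>.\<close>

definition hom_map ::
  "nat \<Rightarrow> (nat \<Rightarrow> ('n::finite) tensor) \<Rightarrow> real ^ 'n \<Rightarrow> real \<Rightarrow> real ^ 'n \<Rightarrow> real ^ 'n" where
  "hom_map m \<Lambda> a s u =
     (\<Sum>k = 1..m - 1. s ^ (k - 1) *\<^sub>R tensor_pow (\<Lambda> k) u (m - k)) + s ^ (m - 1) *\<^sub>R a"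

lemma prod_list_scaleR: "(\<Prod>i\<leftarrow>js. (c *\<^sub>R x) $ i) = c ^ length js * (\<Prod>i\<leftarrow>js. x $ i)"
  for x :: "real ^ 'n"
  by (induction js) (simp_all add: algebra_simps)

lemma tensor_pow_scaleR: "tensor_pow A (c *\<^sub>R x) r = c ^ r *\<^sub>R tensor_pow A x r"
  unfolding tensor_pow_def vec_eq_iff
  by (simp only: prod_list_scaleR vector_scaleR_component vec_lambda_beta)
    (auto simp: sum_distrib_left intro!: sum.cong)

text \<open>The weight gives \<open>s ^ (k - 1)\<close> and the homogeneity of the tensor power
  gives \<open>s ^ (m - k)\<close>; for every \<open>k\<close> in the range the exponents add up to
  \<open>m - 1\<close>.\<close>

lemma hom_map_scaleR: "hom_map m \<Lambda> a s (s *\<^sub>R x) = s ^ (m - 1) *\<^sub>R poly_map m \<Lambda> a x"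
proof -
  have "s ^ (k - 1) * s ^ (m - k) = s ^ (m - 1)" if "k \<in> {1..m - 1}" for k
  proof -
    have "k - 1 + (m - k) = m - 1"
      using that by auto
    then show ?thesis
      by (metis power_add)
  qed
  then show ?thesis
    by (simp add: hom_map_def poly_map_def tensor_pow_scaleR scaleR_add_right scaleR_sum_right)
qed

text \<open>As \<open>0 ^ 0 = 1\<close>, only the term \<open>k = 1\<close> survives;
  \<open>m \<ge> 2\<close> puts this index in the range and kills the constant term.\<close>

lemma hom_map_0:
  assumes "m \<ge> 2"
  shows "hom_map m \<Lambda> a 0 u = tensor_pow (\<Lambda> 1) u (m - 1)"
proof -
  have "(\<Sum>k = 1..m - 1. 0 ^ (k - 1) *\<^sub>R tensor_pow (\<Lambda> k) u (m - k)) =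
      (\<Sum>k\<in>{1}. tensor_pow (\<Lambda> k) u (m - k))"
    using assms by (intro sum.mono_neutral_cong_right) auto
  then show ?thesis
    using assms by (simp add: hom_map_def)
qed

lemma continuous_on_prod_list_component:
  fixes f :: "'a::topological_space \<Rightarrow> real ^ 'n"
  assumes "continuous_on S f"
  shows "continuous_on S (\<lambda>z. \<Prod>i\<leftarrow>js. f z $ i)"
  by (induction js) (use assms in \<open>auto intro!: continuous_intros\<close>)

lemma continuous_on_tensor_pow [continuous_intros]:
  assumes "continuous_on S f"
  shows "continuous_on S (\<lambda>z. tensor_pow A (f z) r)"
  unfolding tensor_pow_def
  by (intro continuous_intros continuous_on_prod_list_component assms)

lemma continuous_on_hom_map [continuous_intros]:
  assumes "continuous_on S a" "continuous_on S s" "continuous_on S u"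
  shows "continuous_on S (\<lambda>z. hom_map m \<Lambda> (a z) (s z) (u z))"
  unfolding hom_map_def by (intro continuous_intros assms)

lemma closed_dual_cone: "closed (dual_cone K)"
proof -
  have "dual_cone K = (\<Inter>x\<in>K. {y. y \<bullet> x \<ge> 0})"
    by (auto simp: dual_cone_def)
  then show ?thesis
    by (auto intro!: closed_INT closed_Collect_le continuous_intros)
qed

lemma conic_dual_cone: "conic (dual_cone K)"
  by (auto simp: conic_def dual_cone_def)

lemma conic_scaleR_iff:
  assumes "conic K" "0 < c"
  shows "c *\<^sub>R x \<in> K \<longleftrightarrow> x \<in> K"
proof
  assume "c *\<^sub>R x \<in> K"
  then have "inverse c *\<^sub>R c *\<^sub>R x \<in> K"
    using conic_mul[OF assms(1), of "c *\<^sub>R x" "inverse c"] assms(2) by simp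
  then show "x \<in> K"
    using assms by simp
qed (use assms in \<open>simp add: conic_mul\<close>)

text \<open>The two maps get the positive factors \<open>s ^ (m - 1)\<close> and
  \<open>s ^ (l - 1)\<close>. These may differ, but membership in a cone and orthogonality survive
  separate positive scaling.\<close>

lemma SOL_iff_hom_map:
  assumes "conic K" "s > 0"
  shows "x \<in> SOL m l \<Lambda> a \<Theta> b K \<longleftrightarrow>
    hom_map m \<Lambda> a s (s *\<^sub>R x) \<in> K \<and> hom_map l \<Theta> b s (s *\<^sub>R x) \<in> dual_cone K \<and>
    hom_map m \<Lambda> a s (s *\<^sub>R x) \<bullet> hom_map l \<Theta> b s (s *\<^sub>R x) = 0"
  using assms by (simp add: SOL_def hom_map_scaleR conic_scaleR_iff conic_dual_cone)

theorem proposition4p3: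
  fixes m l :: nat
    and \<Lambda> \<Theta> :: "nat \<Rightarrow> ('n::finite) tensor"
    and K :: "(real ^ 'n) set"
  assumes "CARD('n) \<ge> 2" and "m \<ge> 2" and "l \<ge> 2"
    and "\<Lambda> \<in> tensor_tuples m" and "\<Theta> \<in> tensor_tuples l" and "K \<in> nonzero_closed_convex_cones"
    and "R0_tensor_pair m l K (\<Lambda> 1) (\<Theta> 1)"
  shows "closed {(a, b). SOL m l \<Lambda> a \<Theta> b K \<noteq> {}}"
proof -
  have "closed K" "conic K"
    using assms(6) by (auto simp: nonzero_closed_convex_cones_def convex_cone_def)
  define H where "H = sphere (0 :: real \<times> (real ^ 'n)) 1 \<inter> {(s, u). s \<ge> 0}"
  \<comment> \<open>The point \<open>(s, u)\<close> comes first and the data \<open>(a, b)\<close>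
    second, so that projecting along the first factor leaves the set of data.\<close>
  define C where "C = {z :: (real \<times> (real ^ 'n)) \<times> (real ^ 'n) \<times> (real ^ 'n).
    hom_map m \<Lambda> (fst (snd z)) (fst (fst z)) (snd (fst z)) \<in> K \<and>
    hom_map l \<Theta> (snd (snd z)) (fst (fst z)) (snd (fst z)) \<in> dual_cone K \<and>
    hom_map m \<Lambda> (fst (snd z)) (fst (fst z)) (snd (fst z)) \<bullet>
      hom_map l \<Theta> (snd (snd z)) (fst (fst z)) (snd (fst z)) = 0}"
  have "closed {(s::real, u::(real ^ 'n)). s \<ge> 0}"
    unfolding case_prod_beta by (intro closed_Collect_le continuous_intros)
  then have "compact H"
    unfolding H_def by (intro compact_Int_closed compact_sphere)
  have pre: "closed {z. f z \<in> T}" if "closed T" "continuous_on UNIV f"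
    for f :: "(real \<times> (real ^ 'n)) \<times> (real ^ 'n) \<times> (real ^ 'n) \<Rightarrow> real ^ 'n" and T
    using closed_vimage[OF that] by (simp add: vimage_def)
  have "closed C"
    unfolding C_def
    by (intro closed_Collect_conj closed_Collect_eq pre \<open>closed K\<close> closed_dual_cone continuous_intros)
  have "SOL m l \<Lambda> a \<Theta> b K \<noteq> {} \<longleftrightarrow> (\<exists>p\<in>H. (p, a, b) \<in> C)" for a b
  proof
    assume "SOL m l \<Lambda> a \<Theta> b K \<noteq> {}"
    then obtain x where x: "x \<in> SOL m l \<Lambda> a \<Theta> b K"
      by blast
    \<comment> \<open>This choice puts \<open>s *\<^sub>R (1, x)\<close> on the unit sphere.\<close>
    define s where "s = 1 / norm (1 :: real, x)"
    have "s > 0"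
      by (simp add: s_def zero_prod_def)
    have "norm (s, s *\<^sub>R x) = norm (s *\<^sub>R (1 :: real, x))"
      by simp
    also have "\<dots> = 1"
      unfolding norm_scaleR by (simp add: s_def zero_prod_def)
    finally have "(s, s *\<^sub>R x) \<in> H"
      using \<open>s > 0\<close> by (simp add: H_def)
    moreover have "((s, s *\<^sub>R x), a, b) \<in> C"
      using x SOL_iff_hom_map[OF \<open>conic K\<close> \<open>s > 0\<close>] by (simp add: C_def)
    ultimately show "\<exists>p\<in>H. (p, a, b) \<in> C"
      by blast
  next
    assume "\<exists>p\<in>H. (p, a, b) \<in> C"
    then obtain s u where su: "(s, u) \<in> H" "((s, u), a, b) \<in> C"
      by auto
    \<comment> \<open>At \<open>s = 0\<close> the data \<open>a\<close> and \<open>b\<close> drop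
      out and \<open>u\<close> is a unit vector, so \<open>u\<close> would violate the
      \<open>R0_tensor_pair\<close> condition.\<close>
    have "s \<noteq> 0"
    proof
      assume "s = 0"
      then have "u \<noteq> 0"
        using su(1) by (auto simp: H_def zero_prod_def[symmetric])
      then show False
        using su(2) assms(7) \<open>s = 0\<close> \<open>m \<ge> 2\<close> \<open>l \<ge> 2\<close>
        by (auto simp: C_def R0_tensor_pair_def hom_map_0)
    qed
    then have "s > 0"
      using su(1) by (simp add: H_def)
    \<comment> \<open>Dehomogenise: \<open>u\<close> is \<open>s\<close> times this point, so the
      equivalence can be read backwards.\<close>
    then have "(1 / s) *\<^sub>R u \<in> SOL m l \<Lambda> a \<Theta> b K"
      using su(2) SOL_iff_hom_map[OF \<open>conic K\<close> \<open>s > 0\<close>, of "(1 / s) *\<^sub>R u"]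
      by (simp add: C_def)
    then show "SOL m l \<Lambda> a \<Theta> b K \<noteq> {}"
      by blast
  qed
  then have "{(a, b). SOL m l \<Lambda> a \<Theta> b K \<noteq> {}} = {y. \<exists>p. p \<in> H \<and> (p, y) \<in> C}"
    by auto
  \<comment> \<open>Projection along a compact factor maps closed sets to closed sets.\<close>
  then show ?thesis
    using closed_compact_projection[OF \<open>compact H\<close> \<open>closed C\<close>] by simp
qed

end
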